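(* Let $G$ be a finite group and let $\gamma=\{\gamma_j:\{1,2,\dots,k\}\to\mathbb{C}\}_{j=0,1,\dots,J}$ be a kernel satisfying $$\sum_{j=1}^J|\gamma_j(r)|^2=1-|\gamma_0(r)|^2,\qquad r=1,2,\dots,k.$$ Then the associated $G$-scattering transform satisfies, for every $f\in L^2(G)$, $$\|S[P_J]f\|_{2,J}\le\|f\|.$$
   Context: $G$ is a finite group (not necessarily abelian). $L^2(G)$ is the space of all functions $f:G\to\mathbb{C}$ with inner product $\langle f,g\rangle=\frac{1}{|G|}\sum_{x\in G}f(x)\overline{g(x)}$ and induced norm $\|f\|$. Convolution is $f*g(x)=\frac{1}{|G|}\sum_{y\in G}f(y)g(y^{-1}x)$. $\pi^1,\dots,\pi^k$ is a complete system of pairwise inequivalent irreducible unitary representations of $G$, $d_r$ is the degree of $\pi^r$ and $\chi^r(x)=\mathrm{Tr}(\pi^r(x))$. Fix an integer $J\ge1$. A kernel is a family of functions $\gamma=\{\gamma_j:\{1,\dots,k\}\to\mathbb{C}\}_{0\le j\le J}$; its $G$-wavelets are $\psi_j(x)=\sum_{r=1}^k d_r\gamma_j(r)\chi^r(x)$, $0\le j\le J$, and we write $\phi=\psi_0$. For $m\ge1$, $\Lambda_J^m=\{1,\dots,J\}^m$ is the set of paths of length $m$; $\Lambda_J^0$ consists only of the empty path $\emptyset$; $P_J=\bigcup_{m\ge0}\Lambda_J^m$. For $f\in L^2(G)$, $U[\emptyset]f=f$, $U[j]f=|\psi_j*f|$ (pointwise modulus) for $1\le j\le J$, and $U[p]f=U[j_m]\cdots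 U[j_1]f$ for $p=(j_1,\dots,j_m)\in\Lambda_J^m$. For $p\in P_J$, $S[p]f=\phi*U[p]f$. The $G$-scattering transform is $S[P_J]f=\{S[p]f\}_{p\in P_J}$, and for a family $F=\{F_p\}_{p\in P_J}$ in $L^2(G)$, $\|F\|_{2,J}=\left(\sum_{p\in P_J}\|F_p\|^2\right)^{1/2}$. *)

theory Defs
  imports
    "HOL-Analysis.Infinite_Sum"
    "HOL-Algebra.Group"
    "Jordan_Normal_Form.VS_Connect"
    "Jordan_Normal_Form.Schur_Decomposition"
begin

section \<open>Functions on a finite group\<close>

text \<open>
  An element of \<open>L\<^sup>2(G)\<close> is represented by a function on the whole ambient type; only its
  values on \<open>carrier G\<close> enter the definitions below.
\<close>

definition L2_inner :: "('a, 'b) monoid_scheme \<Rightarrow> ('a \<Rightarrow> complex) \<Rightarrow> ('a \<Rightarrow> complex) \<Rightarrow> complex" where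
  "L2_inner G f g = 1 / of_nat (card (carrier G)) * (\<Sum>x\<in>carrier G. f x * cnj (g x))"

definition L2_norm :: "('a, 'b) monoid_scheme \<Rightarrow> ('a \<Rightarrow> complex) \<Rightarrow> real" where
  "L2_norm G f = sqrt (Re (L2_inner G f f))"

definition convolution ::
    "('a, 'b) monoid_scheme \<Rightarrow> ('a \<Rightarrow> complex) \<Rightarrow> ('a \<Rightarrow> complex) \<Rightarrow> 'a \<Rightarrow> complex" where
  "convolution G f g x =
     1 / of_nat (card (carrier G)) * (\<Sum>y\<in>carrier G. f y * g (inv\<^bsub>G\<^esub> y \<otimes>\<^bsub>G\<^esub> x))"

section \<open>Unitary matrix representations\<close>

text \<open>
  Since \<open>\<pi> \<one>\<close> is an idempotent unitary matrix, \<open>\<pi> \<one> = 1\<^sub>m n\<close> is automatic.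
\<close>

definition unitary_rep :: "('a, 'b) monoid_scheme \<Rightarrow> nat \<Rightarrow> ('a \<Rightarrow> complex mat) \<Rightarrow> bool" where
  "unitary_rep G n \<pi> \<longleftrightarrow>
     \<pi> \<in> hom G (ring_mat TYPE(complex) n ()) \<and>
     (\<forall>x\<in>carrier G. \<pi> x * mat_adjoint (\<pi> x) = 1\<^sub>m n \<and> mat_adjoint (\<pi> x) * \<pi> x = 1\<^sub>m n)"

definition invariant_subspace ::
    "('a, 'b) monoid_scheme \<Rightarrow> nat \<Rightarrow> ('a \<Rightarrow> complex mat) \<Rightarrow> complex vec set \<Rightarrow> bool" where
  "invariant_subspace G n \<pi> W \<longleftrightarrow>
     VectorSpace.subspace class_ring W (module_vec TYPE(complex) n) \<and>
     (\<forall>x\<in>carrier G. \<forall>v\<in>W. \<pi> x *\<^sub>v v \<in> W)"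

definition irreducible_unitary_rep ::
    "('a, 'b) monoid_scheme \<Rightarrow> nat \<Rightarrow> ('a \<Rightarrow> complex mat) \<Rightarrow> bool" where
  "irreducible_unitary_rep G n \<pi> \<longleftrightarrow>
     unitary_rep G n \<pi> \<and> n > 0 \<and>
     (\<forall>W. invariant_subspace G n \<pi> W \<longrightarrow> W = {0\<^sub>v n} \<or> W = carrier_vec n)"

definition equivalent_reps ::
    "('a, 'b) monoid_scheme \<Rightarrow> nat \<Rightarrow> ('a \<Rightarrow> complex mat) \<Rightarrow> nat \<Rightarrow> ('a \<Rightarrow> complex mat) \<Rightarrow> bool" where
  "equivalent_reps G n \<pi> m \<rho> \<longleftrightarrow>
     n = m \<and> (\<exists>T \<in> carrier_mat n n. invertible_mat T \<and> (\<forall>x\<in>carrier G. T * \<pi> x = \<rho> x * T))"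

definition complete_irrep_system ::
    "('a, 'b) monoid_scheme \<Rightarrow> nat \<Rightarrow> (nat \<Rightarrow> nat) \<Rightarrow> (nat \<Rightarrow> 'a \<Rightarrow> complex mat) \<Rightarrow> bool" where
  "complete_irrep_system G k d \<pi> \<longleftrightarrow>
     (\<forall>r\<in>{1..k}. irreducible_unitary_rep G (d r) (\<pi> r)) \<and>
     (\<forall>r\<in>{1..k}. \<forall>s\<in>{1..k}. r \<noteq> s \<longrightarrow> \<not> equivalent_reps G (d r) (\<pi> r) (d s) (\<pi> s)) \<and>
     (\<forall>n \<rho>. irreducible_unitary_rep G n \<rho> \<longrightarrow>
        (\<exists>r\<in>{1..k}. equivalent_reps G n \<rho> (d r) (\<pi> r)))"

definition mat_trace :: "complex mat \<Rightarrow> complex" where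
  "mat_trace A = (\<Sum>i<dim_row A. A $$ (i, i))"

definition rep_character :: "('a \<Rightarrow> complex mat) \<Rightarrow> 'a \<Rightarrow> complex" where
  "rep_character \<pi> x = mat_trace (\<pi> x)"

section \<open>Wavelets and the scattering transform\<close>

text \<open>
  A kernel \<open>\<gamma>\<close> is used only at arguments \<open>j \<in> {0..J}\<close> and \<open>r \<in> {1..k}\<close>.
\<close>

definition wavelet ::
    "nat \<Rightarrow> (nat \<Rightarrow> nat) \<Rightarrow> (nat \<Rightarrow> 'a \<Rightarrow> complex mat) \<Rightarrow> (nat \<Rightarrow> nat \<Rightarrow> complex) \<Rightarrow>
     nat \<Rightarrow> 'a \<Rightarrow> complex" where
  "wavelet k d \<pi> \<gamma> j x = (\<Sum>r=1..k. of_nat (d r) * \<gamma> j r * rep_character (\<pi> r) x)"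

definition paths_of_length :: "nat \<Rightarrow> nat \<Rightarrow> nat list set" where
  "paths_of_length J m = {p. length p = m \<and> set p \<subseteq> {1..J}}"

definition scattering_paths :: "nat \<Rightarrow> nat list set" where
  "scattering_paths J = (\<Union>m. paths_of_length J m)"

text \<open>
  The propagator and the transform take the whole family \<open>\<psi>\<close> of wavelets. The first entry of
  a path acts first: \<open>U[(j\<^sub>1, \<dots>, j\<^sub>m)] f = U[j\<^sub>m] (\<dots> (U[j\<^sub>1] f))\<close>.
\<close>

fun propagator ::
    "('a, 'b) monoid_scheme \<Rightarrow> (nat \<Rightarrow> 'a \<Rightarrow> complex) \<Rightarrow> nat list \<Rightarrow> ('a \<Rightarrow> complex) \<Rightarrow> 'a \<Rightarrow> complex" where
  "propagator G \<psi> [] f = f"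
| "propagator G \<psi> (j # p) f =
     propagator G \<psi> p (\<lambda>x. complex_of_real (cmod (convolution G (\<psi> j) f x)))"

definition scattering ::
    "('a, 'b) monoid_scheme \<Rightarrow> (nat \<Rightarrow> 'a \<Rightarrow> complex) \<Rightarrow> ('a \<Rightarrow> complex) \<Rightarrow> nat list \<Rightarrow> 'a \<Rightarrow> complex" where
  "scattering G \<psi> f p = convolution G (\<psi> 0) (propagator G \<psi> p f)"

text \<open>
  The sum over all paths is infinite, and \<open>infsum\<close> is \<open>0\<close> for families that are not
  summable. The norm is therefore meaningful only together with \<open>finite_path_norm\<close>, which
  says that it is finite.
\<close>

definition finite_path_norm ::
    "('a, 'b) monoid_scheme \<Rightarrow> nat \<Rightarrow> (nat list \<Rightarrow> 'a \<Rightarrow> complex) \<Rightarrow> bool" where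
  "finite_path_norm G J F \<longleftrightarrow> (\<lambda>p. (L2_norm G (F p))\<^sup>2) summable_on scattering_paths J"

definition path_norm ::
    "('a, 'b) monoid_scheme \<Rightarrow> nat \<Rightarrow> (nat list \<Rightarrow> 'a \<Rightarrow> complex) \<Rightarrow> real" where
  "path_norm G J F = sqrt (\<Sum>\<^sub>\<infinity>p\<in>scattering_paths J. (L2_norm G (F p))\<^sup>2)"

end

theory Submission
  imports Defs "Jordan_Normal_Form.Spectral_Radius"
begin

text \<open>
  Put \<open>e\<^sub>r = d\<^sub>r \<chi>\<^sup>r\<close>. By Schur orthogonality, \<open>e\<^sub>r * e\<^sub>s\<close> is \<open>e\<^sub>r\<close> for \<open>r = s\<close> and \<open>0\<close> otherwise,
  and \<open>e\<^sub>r(x\<^sup>-\<^sup>1)\<close> is the conjugate of \<open>e\<^sub>r(x)\<close>; hence the operators \<open>f \<mapsto> e\<^sub>r * f\<close> are mutually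
  orthogonal projections of \<open>L\<^sup>2(G)\<close>. As \<open>\<psi>\<^sub>j * f = \<Sum>\<^sub>r \<gamma>\<^sub>j(r) (e\<^sub>r * f)\<close>, the condition on the kernel
  and Bessel's inequality give
  \<open>\<Sum>\<^sub>j \<parallel>\<psi>\<^sub>j * f\<parallel>\<^sup>2 = \<Sum>\<^sub>r (\<Sum>\<^sub>j \<bar>\<gamma>\<^sub>j(r)\<bar>\<^sup>2) \<parallel>e\<^sub>r * f\<parallel>\<^sup>2 = \<Sum>\<^sub>r \<parallel>e\<^sub>r * f\<parallel>\<^sup>2 \<le> \<parallel>f\<parallel>\<^sup>2\<close>,
  where \<open>j\<close> runs from \<open>0\<close> to \<open>J\<close> (\<open>convolution_idempotents_energy\<close>, \<open>wavelet_energy\<close>).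

  Since the modulus preserves the norm, this bound can be iterated: the energy of a signal
  dominates the output energy \<open>\<parallel>\<phi> * f\<parallel>\<^sup>2\<close> together with the total energy of the signals
  \<open>\<bar>\<psi>\<^sub>j * f\<bar>\<close>, \<open>1 \<le> j \<le> J\<close>, that are passed on. By induction the output energy over all paths
  of length below \<open>m\<close> is at most \<open>\<parallel>f\<parallel>\<^sup>2\<close> (\<open>scattering_finite_energy\<close>). Every finite sum over paths is
  therefore bounded by \<open>\<parallel>f\<parallel>\<^sup>2\<close>, which gives summability and the bound for the sum.

  Schur orthogonality is derived from Schur's lemma by averaging matrix units over the group
  (\<open>irreducible_commuting_scalar\<close>, \<open>irreducible_intertwiner_zero\<close>).
\<close>

section \<open>Adjoint matrices\<close>

lemma dim_mat_adjoint [simp]: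
  "dim_row (mat_adjoint A) = dim_col A" "dim_col (mat_adjoint A) = dim_row A"
  unfolding mat_adjoint_def by auto

lemma index_mat_adjoint [simp]:
  fixes A :: "complex mat"
  assumes "i < dim_col A" "j < dim_row A"
  shows "mat_adjoint A $$ (i, j) = cnj (A $$ (j, i))"
  using assms unfolding mat_adjoint_def by (auto simp: mat_of_rows_def)

lemma mat_adjoint_carrier [simp]:
  "A \<in> carrier_mat n m \<Longrightarrow> mat_adjoint A \<in> carrier_mat m n"
  by (rule carrier_matI) auto

lemma mult_mat_index:
  assumes "A \<in> carrier_mat n m" "B \<in> carrier_mat m p" "i < n" "j < p"
  shows "(A * B) $$ (i, j) = (\<Sum>k<m. A $$ (i, k) * B $$ (k, j))"
  using assms by (auto simp: scalar_prod_def atLeast0LessThan intro!: sum.cong)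

lemma mat_adjoint_mult:
  fixes A B :: "complex mat"
  assumes "A \<in> carrier_mat n m" "B \<in> carrier_mat m p"
  shows "mat_adjoint (A * B) = mat_adjoint B * mat_adjoint A"
proof (rule eq_matI)
  fix i j assume "i < dim_row (mat_adjoint B * mat_adjoint A)" "j < dim_col (mat_adjoint B * mat_adjoint A)"
  then have ij: "i < p" "j < n" using assms by auto
  have "mat_adjoint (A * B) $$ (i, j) = cnj (\<Sum>k<m. A $$ (j, k) * B $$ (k, i))"
    using ij assms mult_mat_index[OF assms ij(2,1)] by simp
  also have "\<dots> = (\<Sum>k<m. mat_adjoint B $$ (i, k) * mat_adjoint A $$ (k, j))"
    unfolding cnj_sum using ij assms by (intro sum.cong) auto
  also have "\<dots> = (mat_adjoint B * mat_adjoint A) $$ (i, j)"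
    using assms ij by (intro mult_mat_index[symmetric]) auto
  finally show "mat_adjoint (A * B) $$ (i, j) = (mat_adjoint B * mat_adjoint A) $$ (i, j)" .
qed (use assms in auto)

lemma mat_trace_comm:
  assumes "A \<in> carrier_mat n m" "B \<in> carrier_mat m n"
  shows "mat_trace (A * B) = mat_trace (B * A)"
proof -
  have "mat_trace (A * B) = (\<Sum>i<n. \<Sum>k<m. A $$ (i, k) * B $$ (k, i))"
    unfolding mat_trace_def using assms mult_mat_index[OF assms] by auto
  also have "\<dots> = (\<Sum>k<m. \<Sum>i<n. B $$ (k, i) * A $$ (i, k))"
    by (subst sum.swap) (simp add: mult.commute)
  also have "\<dots> = mat_trace (B * A)"
    unfolding mat_trace_def using assms mult_mat_index[OF assms(2,1)] by auto
  finally show ?thesis .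
qed

lemma mat_trace_smult_one: "mat_trace (c \<cdot>\<^sub>m 1\<^sub>m n) = c * of_nat n"
  unfolding mat_trace_def by simp

lemma mat_trace_mult_adjoint_eq_0:
  fixes A :: "complex mat"
  assumes A: "A \<in> carrier_mat n m" and 0: "mat_trace (A * mat_adjoint A) = 0"
  shows "A = 0\<^sub>m n m"
proof -
  have "mat_trace (A * mat_adjoint A) = (\<Sum>i<n. \<Sum>k<m. A $$ (i, k) * mat_adjoint A $$ (k, i))"
    unfolding mat_trace_def using A mult_mat_index[OF A mat_adjoint_carrier[OF A]] by auto
  also have "\<dots> = (\<Sum>i<n. \<Sum>k<m. of_real ((cmod (A $$ (i, k)))\<^sup>2))"
    using A by (intro sum.cong) (auto simp: complex_norm_square[symmetric])
  also have "\<dots> = of_real (\<Sum>i<n. \<Sum>k<m. (cmod (A $$ (i, k)))\<^sup>2)" by simp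
  finally have "(\<Sum>i<n. \<Sum>k<m. (cmod (A $$ (i, k)))\<^sup>2) = 0"
    using 0 of_real_eq_0_iff by metis
  then have "\<forall>i<n. \<forall>k<m. A $$ (i, k) = 0"
    by (simp add: sum_nonneg_eq_0_iff sum_nonneg)
  with A show ?thesis by (intro eq_matI) auto
qed

section \<open>Schur's lemma\<close>

context group
begin

lemma unitary_repD:
  assumes "unitary_rep G n \<pi>"
  shows unitary_rep_carrier: "x \<in> carrier G \<Longrightarrow> \<pi> x \<in> carrier_mat n n"
    and unitary_rep_mult: "x \<in> carrier G \<Longrightarrow> y \<in> carrier G \<Longrightarrow> \<pi> (x \<otimes> y) = \<pi> x * \<pi> y"
  using assms unfolding unitary_rep_def hom_def by (auto simp: ring_mat_simps)

lemma unitary_rep_one: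
  assumes "unitary_rep G n \<pi>"
  shows "\<pi> \<one> = 1\<^sub>m n"
proof -
  note c = unitary_rep_carrier[OF assms one_closed]
  have u: "\<pi> \<one> * mat_adjoint (\<pi> \<one>) = 1\<^sub>m n" using assms unfolding unitary_rep_def by auto
  have "\<pi> \<one> = \<pi> \<one> * (\<pi> \<one> * mat_adjoint (\<pi> \<one>))" using u c by simp
  also have "\<dots> = (\<pi> \<one> * \<pi> \<one>) * mat_adjoint (\<pi> \<one>)"
    using c by (intro assoc_mult_mat[symmetric]) auto
  also have "\<dots> = 1\<^sub>m n" using u unitary_rep_mult[OF assms one_closed one_closed] by simp
  finally show ?thesis .
qed

lemma unitary_rep_inv:
  assumes "unitary_rep G n \<pi>" "x \<in> carrier G"
  shows "\<pi> (inv x) = mat_adjoint (\<pi> x)"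
proof -
  note c = unitary_rep_carrier[OF assms] unitary_rep_carrier[OF assms(1) inv_closed[OF assms(2)]]
  have u: "\<pi> x * mat_adjoint (\<pi> x) = 1\<^sub>m n" using assms unfolding unitary_rep_def by auto
  have "\<pi> (inv x) = \<pi> (inv x) * (\<pi> x * mat_adjoint (\<pi> x))" using u c by simp
  also have "\<dots> = (\<pi> (inv x) * \<pi> x) * mat_adjoint (\<pi> x)"
    using c by (intro assoc_mult_mat[symmetric]) auto
  also have "\<pi> (inv x) * \<pi> x = 1\<^sub>m n"
    using unitary_rep_mult[OF assms(1) inv_closed[OF assms(2)] assms(2)] unitary_rep_one[OF assms(1)] assms
    by simp
  finally show ?thesis using c by simp
qed

text \<open>
  An eigenspace of a matrix commuting with an irreducible representation is invariant and nonzero,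
  hence the whole space.
\<close>

lemma irreducible_commuting_scalar:
  assumes irr: "irreducible_unitary_rep G n \<pi>" and T: "T \<in> carrier_mat n n"
    and comm: "\<And>x. x \<in> carrier G \<Longrightarrow> \<pi> x * T = T * \<pi> x"
  shows "\<exists>c. T = c \<cdot>\<^sub>m 1\<^sub>m n"
proof -
  have rep: "unitary_rep G n \<pi>" and n: "n > 0"
    using irr unfolding irreducible_unitary_rep_def by auto
  obtain c v where v: "v \<in> carrier_vec n" "v \<noteq> 0\<^sub>v n" "T *\<^sub>v v = c \<cdot>\<^sub>v v"
    using spectrum_non_empty[OF T n] T unfolding spectrum_def eigenvalue_def eigenvector_def by auto
  define W where "W = {v \<in> carrier_vec n. T *\<^sub>v v = c \<cdot>\<^sub>v v}"
  have "VectorSpace.subspace class_ring W (module_vec TYPE(complex) n)"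
  proof (intro subspace.intro submodule.intro vec_vs vec_module)
    fix u w assume "u \<in> W" "w \<in> W"
    then show "u \<oplus>\<^bsub>module_vec TYPE(complex) n\<^esub> w \<in> W"
      unfolding W_def module_vec_simps
      using T by (auto simp: mult_add_distrib_mat_vec smult_add_distrib_vec)
  next
    fix a u assume "a \<in> carrier (class_ring :: complex ring)" and "u \<in> W"
    then show "a \<odot>\<^bsub>module_vec TYPE(complex) n\<^esub> u \<in> W"
      unfolding W_def module_vec_simps
      using T by (auto simp: mult_mat_vec smult_smult_assoc mult.commute)
  qed (use T in \<open>auto simp: W_def module_vec_simps\<close>)
  moreover have "\<pi> x *\<^sub>v w \<in> W" if x: "x \<in> carrier G" and w: "w \<in> W" for x w
  proof -
    note c = unitary_rep_carrier[OF rep x]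
    have w': "w \<in> carrier_vec n" "T *\<^sub>v w = c \<cdot>\<^sub>v w" using w by (auto simp: W_def)
    have "T *\<^sub>v (\<pi> x *\<^sub>v w) = (\<pi> x * T) *\<^sub>v w"
      using assoc_mult_mat_vec[OF T c w'(1)] comm[OF x] by simp
    also have "\<dots> = c \<cdot>\<^sub>v (\<pi> x *\<^sub>v w)"
      using assoc_mult_mat_vec[OF c T w'(1)] mult_mat_vec[OF c w'(1)] w'(2) by simp
    finally show ?thesis using c w' by (auto simp: W_def)
  qed
  ultimately have "W = {0\<^sub>v n} \<or> W = carrier_vec n"
    using irr unfolding irreducible_unitary_rep_def invariant_subspace_def by auto
  moreover have "v \<in> W" using v by (auto simp: W_def)
  ultimately have W: "W = carrier_vec n" using v by auto
  have "T = c \<cdot>\<^sub>m 1\<^sub>m n"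
  proof (rule eq_matI)
    fix i j assume "i < dim_row (c \<cdot>\<^sub>m 1\<^sub>m n :: complex mat)" "j < dim_col (c \<cdot>\<^sub>m 1\<^sub>m n :: complex mat)"
    then have ij: "i < n" "j < n" by auto
    have "unit_vec n j \<in> W" using W by simp
    then have "T *\<^sub>v unit_vec n j = c \<cdot>\<^sub>v unit_vec n j" by (auto simp: W_def)
    then have "(T *\<^sub>v unit_vec n j) $ i = (c \<cdot>\<^sub>v unit_vec n j) $ i" by simp
    moreover have "(T *\<^sub>v unit_vec n j) $ i = T $$ (i, j)"
      using T ij by (simp add: scalar_prod_right_unit)
    ultimately show "T $$ (i, j) = (c \<cdot>\<^sub>m 1\<^sub>m n) $$ (i, j)" using ij by auto
  qed (use T in auto)
  then show ?thesis by blast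
qed

lemma intertwiner_adjoint:
  assumes \<pi>: "unitary_rep G n \<pi>" and \<rho>: "unitary_rep G m \<rho>" and T: "T \<in> carrier_mat n m"
    and comm: "\<And>x. x \<in> carrier G \<Longrightarrow> \<pi> x * T = T * \<rho> x" and x: "x \<in> carrier G"
  shows "\<rho> x * mat_adjoint T = mat_adjoint T * \<pi> x"
proof -
  have i: "inv x \<in> carrier G" using x by simp
  have *: "\<pi> x = mat_adjoint (\<pi> (inv x))" "\<rho> x = mat_adjoint (\<rho> (inv x))"
    using unitary_rep_inv[OF \<pi> i] unitary_rep_inv[OF \<rho> i] x by auto
  show ?thesis
    unfolding * using comm[OF i]
      mat_adjoint_mult[OF unitary_rep_carrier[OF \<pi> i] T]
      mat_adjoint_mult[OF T unitary_rep_carrier[OF \<rho> i]] by simp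
qed

text \<open>
  If \<open>T\<close> intertwines two irreducible unitary representations, then so does its adjoint in the
  opposite direction, so \<open>T T\<^sup>*\<close> and \<open>T\<^sup>* T\<close> are scalar. If \<open>T \<noteq> 0\<close>, the two scalars agree because
  \<open>(T T\<^sup>*) T = T (T\<^sup>* T)\<close>, and are nonzero because the trace of \<open>T T\<^sup>*\<close> is the sum of the squared moduli
  of the entries of \<open>T\<close>. Comparison of traces gives equality of the degrees, and so a multiple of \<open>T\<^sup>*\<close> inverts \<open>T\<close>.
  This uses the adjoint in place of a dimension count for kernel and image.
\<close>

lemma irreducible_intertwiner_zero:
  assumes \<pi>: "irreducible_unitary_rep G n \<pi>" and \<rho>: "irreducible_unitary_rep G m \<rho>"
    and ne: "\<not> equivalent_reps G m \<rho> n \<pi>" and T: "T \<in> carrier_mat n m"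
    and comm: "\<And>x. x \<in> carrier G \<Longrightarrow> \<pi> x * T = T * \<rho> x"
  shows "T = 0\<^sub>m n m"
proof (rule ccontr)
  assume nz: "T \<noteq> 0\<^sub>m n m"
  let ?A = "mat_adjoint T"
  have rep: "unitary_rep G n \<pi>" "unitary_rep G m \<rho>"
    using \<pi> \<rho> unfolding irreducible_unitary_rep_def by auto
  have A: "?A \<in> carrier_mat m n" using T by simp
  have comm': "\<rho> x * ?A = ?A * \<pi> x" if "x \<in> carrier G" for x
    using intertwiner_adjoint[OF rep T comm that] by simp
  have "\<exists>a. T * ?A = a \<cdot>\<^sub>m 1\<^sub>m n"
  proof (rule irreducible_commuting_scalar[OF \<pi>])
    fix x assume x: "x \<in> carrier G"
    note c = unitary_rep_carrier[OF rep(1) x] unitary_rep_carrier[OF rep(2) x]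
    have "\<pi> x * (T * ?A) = T * \<rho> x * ?A"
      using assoc_mult_mat[OF c(1) T A] comm[OF x] by simp
    also have "\<dots> = T * ?A * \<pi> x"
      using assoc_mult_mat[OF T c(2) A] assoc_mult_mat[OF T A c(1)] comm'[OF x] by simp
    finally show "\<pi> x * (T * ?A) = T * ?A * \<pi> x" .
  qed (use T A in auto)
  then obtain a where a: "T * ?A = a \<cdot>\<^sub>m 1\<^sub>m n" by blast
  have "\<exists>b. ?A * T = b \<cdot>\<^sub>m 1\<^sub>m m"
  proof (rule irreducible_commuting_scalar[OF \<rho>])
    fix x assume x: "x \<in> carrier G"
    note c = unitary_rep_carrier[OF rep(1) x] unitary_rep_carrier[OF rep(2) x]
    have "\<rho> x * (?A * T) = ?A * \<pi> x * T"
      using assoc_mult_mat[OF c(2) A T] comm'[OF x] by simp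
    also have "\<dots> = ?A * T * \<rho> x"
      using assoc_mult_mat[OF A c(1) T] assoc_mult_mat[OF A T c(2)] comm[OF x] by simp
    finally show "\<rho> x * (?A * T) = ?A * T * \<rho> x" .
  qed (use T A in auto)
  then obtain b where b: "?A * T = b \<cdot>\<^sub>m 1\<^sub>m m" by blast
  have tr: "a * of_nat n = b * of_nat m"
    using mat_trace_comm[OF T A] unfolding a b mat_trace_smult_one .
  have "a * of_nat n \<noteq> 0"
    using mat_trace_mult_adjoint_eq_0[OF T] nz unfolding a mat_trace_smult_one by auto
  then have a0: "a \<noteq> 0" by auto
  have "a \<cdot>\<^sub>m T = b \<cdot>\<^sub>m T"
    using assoc_mult_mat[OF T A T] T unfolding a b
    by (simp add: mult_smult_assoc_mat[OF one_carrier_mat T] mult_smult_distrib[OF T one_carrier_mat])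
  moreover obtain i j where ij: "i < n" "j < m" "T $$ (i, j) \<noteq> 0"
    using nz T by (auto simp: mat_eq_iff)
  ultimately have "a * T $$ (i, j) = b * T $$ (i, j)"
    using T by (metis carrier_matD index_smult_mat(1))
  then have ab: "a = b" using ij by simp
  with tr a0 have nm: "m = n" by simp
  have "invertible_mat T"
    unfolding invertible_mat_def inverts_mat_def
  proof (intro conjI exI)
    show "T * ((1 / a) \<cdot>\<^sub>m ?A) = 1\<^sub>m (dim_row T)"
      unfolding mult_smult_distrib[OF T A] a by (rule eq_matI) (use T a0 nm in auto)
    show "((1 / a) \<cdot>\<^sub>m ?A) * T = 1\<^sub>m (dim_row ((1 / a) \<cdot>\<^sub>m ?A))"
      unfolding mult_smult_assoc_mat[OF A T] b by (rule eq_matI) (use T a0 ab nm in auto)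
  qed (use T nm in auto)
  then have "equivalent_reps G m \<rho> n \<pi>"
    unfolding equivalent_reps_def using T nm comm by (intro conjI bexI[of _ T]) auto
  with ne show False by simp
qed

section \<open>Schur orthogonality\<close>

lemma unitary_rep_mult_index:
  assumes "unitary_rep G n \<pi>" "x \<in> carrier G" "y \<in> carrier G" "i < n" "j < n"
  shows "\<pi> (x \<otimes> y) $$ (i, j) = (\<Sum>k<n. \<pi> x $$ (i, k) * \<pi> y $$ (k, j))"
  unfolding unitary_rep_mult[OF assms(1-3)]
  by (rule mult_mat_index[OF unitary_rep_carrier[OF assms(1,2)] unitary_rep_carrier[OF assms(1,3)] assms(4,5)])


lemma sum_translate:
  assumes "a \<in> carrier G"
  shows "(\<Sum>y\<in>carrier G. h (a \<otimes> y)) = (\<Sum>y\<in>carrier G. h y)"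
proof -
  have "bij_betw (\<lambda>y. a \<otimes> y) (carrier G) (carrier G)"
    using assms by (simp add: bij_betw_def inj_on_cmult surj_const_mult)
  then show ?thesis by (rule sum.reindex_bij_betw)
qed

text \<open>
  The average over the group, without the normalising factor, of the matrix unit \<open>E\<^sub>i\<^sub>j\<close>: the matrix
  \<open>\<Sum>\<^sub>y \<pi>(y) E\<^sub>i\<^sub>j \<rho>(y\<^sup>-\<^sup>1)\<close>, of size \<open>n \<times> m\<close>. Its entries are the sums in the Schur orthogonality relations.
\<close>

definition averaged_unit :: "nat \<Rightarrow> ('a \<Rightarrow> complex mat) \<Rightarrow> nat \<Rightarrow> ('a \<Rightarrow> complex mat) \<Rightarrow>
    nat \<Rightarrow> nat \<Rightarrow> complex mat" where
  "averaged_unit n \<pi> m \<rho> i j =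
     mat n m (\<lambda>(p, q). \<Sum>y\<in>carrier G. \<pi> y $$ (p, i) * \<rho> (inv y) $$ (j, q))"

lemma averaged_unit_intertwines:
  assumes \<pi>: "unitary_rep G n \<pi>" and \<rho>: "unitary_rep G m \<rho>" and ij: "i < n" "j < m"
    and z: "z \<in> carrier G"
  shows "\<pi> z * averaged_unit n \<pi> m \<rho> i j = averaged_unit n \<pi> m \<rho> i j * \<rho> z"
proof (rule eq_matI)
  let ?T = "averaged_unit n \<pi> m \<rho> i j"
  have T: "?T \<in> carrier_mat n m" by (simp add: averaged_unit_def)
  note c = unitary_rep_carrier[OF \<pi> z] unitary_rep_carrier[OF \<rho> z]
  fix p q assume "p < dim_row (?T * \<rho> z)" "q < dim_col (?T * \<rho> z)"
  then have pq: "p < n" "q < m" using T c by auto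
  have "(\<pi> z * ?T) $$ (p, q) =
      (\<Sum>l<n. \<pi> z $$ (p, l) * (\<Sum>y\<in>carrier G. \<pi> y $$ (l, i) * \<rho> (inv y) $$ (j, q)))"
    using mult_mat_index[OF c(1) T pq] pq by (simp add: averaged_unit_def)
  also have "\<dots> = (\<Sum>y\<in>carrier G. (\<Sum>l<n. \<pi> z $$ (p, l) * \<pi> y $$ (l, i)) * \<rho> (inv y) $$ (j, q))"
    unfolding sum_distrib_left sum_distrib_right
    by (subst sum.swap) (simp add: mult.assoc)
  also have "\<dots> = (\<Sum>y\<in>carrier G. \<pi> (z \<otimes> y) $$ (p, i) * \<rho> (inv (z \<otimes> y) \<otimes> z) $$ (j, q))"
    using z ij pq by (intro sum.cong)
      (auto simp: unitary_rep_mult_index[OF \<pi>] inv_mult_group m_assoc)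
  also have "\<dots> = (\<Sum>y\<in>carrier G. \<pi> y $$ (p, i) * \<rho> (inv y \<otimes> z) $$ (j, q))"
    by (rule sum_translate[OF z])
  also have "\<dots> = (\<Sum>y\<in>carrier G. \<pi> y $$ (p, i) * (\<Sum>l<m. \<rho> (inv y) $$ (j, l) * \<rho> z $$ (l, q)))"
    using z ij pq by (intro sum.cong) (auto simp: unitary_rep_mult_index[OF \<rho>])
  also have "\<dots> = (\<Sum>l<m. (\<Sum>y\<in>carrier G. \<pi> y $$ (p, i) * \<rho> (inv y) $$ (j, l)) * \<rho> z $$ (l, q))"
    unfolding sum_distrib_left sum_distrib_right
    by (subst sum.swap) (simp add: mult.assoc)
  also have "\<dots> = (?T * \<rho> z) $$ (p, q)"
    using mult_mat_index[OF T c(2) pq] pq by (simp add: averaged_unit_def)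
  finally show "(\<pi> z * ?T) $$ (p, q) = (?T * \<rho> z) $$ (p, q)" .
qed (use unitary_rep_carrier[OF \<pi> z] unitary_rep_carrier[OF \<rho> z] in \<open>auto simp: averaged_unit_def\<close>)

lemma schur_orthogonality_inequivalent:
  assumes \<pi>: "irreducible_unitary_rep G n \<pi>" and \<rho>: "irreducible_unitary_rep G m \<rho>"
    and ne: "\<not> equivalent_reps G m \<rho> n \<pi>" and "p < n" "i < n" "j < m" "q < m"
  shows "(\<Sum>y\<in>carrier G. \<pi> y $$ (p, i) * \<rho> (inv y) $$ (j, q)) = 0"
proof -
  have rep: "unitary_rep G n \<pi>" "unitary_rep G m \<rho>"
    using \<pi> \<rho> unfolding irreducible_unitary_rep_def by auto
  have "averaged_unit n \<pi> m \<rho> i j = 0\<^sub>m n m"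
    using averaged_unit_intertwines[OF rep] assms
    by (intro irreducible_intertwiner_zero[OF \<pi> \<rho> ne]) (auto simp: averaged_unit_def)
  then have "averaged_unit n \<pi> m \<rho> i j $$ (p, q) = 0" using assms by simp
  then show ?thesis using assms by (simp add: averaged_unit_def)
qed

lemma schur_orthogonality_same:
  assumes \<pi>: "irreducible_unitary_rep G n \<pi>" and l: "p < n" "i < n" "j < n" "q < n"
  shows "(\<Sum>y\<in>carrier G. \<pi> y $$ (p, i) * \<pi> (inv y) $$ (j, q)) =
    (if p = q \<and> i = j then of_nat (card (carrier G)) / of_nat n else 0)"
proof -
  have rep: "unitary_rep G n \<pi>" and n: "n > 0"
    using \<pi> unfolding irreducible_unitary_rep_def by auto
  let ?T = "averaged_unit n \<pi> n \<pi> i j"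
  have T: "?T \<in> carrier_mat n n" by (simp add: averaged_unit_def)
  obtain c where c: "?T = c \<cdot>\<^sub>m 1\<^sub>m n"
    using irreducible_commuting_scalar[OF \<pi> T averaged_unit_intertwines[OF rep rep l(2,3)]] by blast
  \<comment> \<open>The scalar is found from the trace, which collapses by \<open>\<pi>(y\<^sup>-\<^sup>1) \<pi>(y) = 1\<close>.\<close>
  have "c * of_nat n = mat_trace ?T" unfolding c mat_trace_smult_one ..
  also have "\<dots> = (\<Sum>y\<in>carrier G. \<Sum>r<n. \<pi> (inv y) $$ (j, r) * \<pi> y $$ (r, i))"
    unfolding mat_trace_def averaged_unit_def by (subst sum.swap) (simp add: mult.commute)
  also have "\<dots> = (\<Sum>y\<in>carrier G. \<pi> (inv y \<otimes> y) $$ (j, i))"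
    using l by (intro sum.cong refl unitary_rep_mult_index[OF rep, symmetric]) auto
  also have "\<dots> = (if i = j then of_nat (card (carrier G)) else 0)"
    using l by (simp add: unitary_rep_one[OF rep])
  finally have "c = (if i = j then of_nat (card (carrier G)) / of_nat n else 0)"
    using n by (auto simp: field_simps split: if_splits)
  moreover have "(\<Sum>y\<in>carrier G. \<pi> y $$ (p, i) * \<pi> (inv y) $$ (j, q)) = ?T $$ (p, q)"
    using l by (simp add: averaged_unit_def)
  ultimately show ?thesis unfolding c using l by simp
qed

section \<open>Characters under convolution\<close>

lemma rep_character_inv:
  assumes "unitary_rep G n \<pi>" "x \<in> carrier G"
  shows "rep_character \<pi> (inv x) = cnj (rep_character \<pi> x)"
  using unitary_rep_carrier[OF assms]
  by (simp add: rep_character_def mat_trace_def unitary_rep_inv[OF assms])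

lemma convolution_rep_character:
  assumes \<pi>: "unitary_rep G n \<pi>" and \<rho>: "unitary_rep G m \<rho>" and x: "x \<in> carrier G"
  shows "convolution G (rep_character \<pi>) (rep_character \<rho>) x =
    1 / of_nat (card (carrier G)) * (\<Sum>i<n. \<Sum>j<m. \<Sum>q<m.
       (\<Sum>y\<in>carrier G. \<pi> y $$ (i, i) * \<rho> (inv y) $$ (j, q)) * \<rho> x $$ (q, j))"
proof -
  have \<pi>': "rep_character \<pi> y = (\<Sum>i<n. \<pi> y $$ (i, i))" if "y \<in> carrier G" for y
    using unitary_rep_carrier[OF \<pi> that] by (simp add: rep_character_def mat_trace_def)
  have \<rho>': "rep_character \<rho> (inv y \<otimes> x) = (\<Sum>j<m. \<Sum>q<m. \<rho> (inv y) $$ (j, q) * \<rho> x $$ (q, j))"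
    if y: "y \<in> carrier G" for y
    using unitary_rep_carrier[OF \<rho> m_closed[OF inv_closed[OF y] x]] x y
    by (simp add: rep_character_def mat_trace_def unitary_rep_mult_index[OF \<rho>])
  have "(\<Sum>y\<in>carrier G. rep_character \<pi> y * rep_character \<rho> (inv y \<otimes> x)) =
      (\<Sum>y\<in>carrier G. \<Sum>i<n. \<Sum>j<m. \<Sum>q<m. \<pi> y $$ (i, i) * \<rho> (inv y) $$ (j, q) * \<rho> x $$ (q, j))"
    by (intro sum.cong refl) (simp only: \<pi>' \<rho>', simp only: sum_distrib_right,
      simp only: sum_distrib_left mult.assoc)
  also have "\<dots> = (\<Sum>i<n. \<Sum>j<m. \<Sum>q<m. \<Sum>y\<in>carrier G. 
      \<pi> y $$ (i, i) * \<rho> (inv y) $$ (j, q) * \<rho> x $$ (q, j))"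
    by (simp only: sum.swap[of _ _ "carrier G"])
  finally show ?thesis by (simp add: convolution_def sum_distrib_right)
qed

lemma convolution_character_inequivalent:
  assumes \<pi>: "irreducible_unitary_rep G n \<pi>" and \<rho>: "irreducible_unitary_rep G m \<rho>"
    and ne: "\<not> equivalent_reps G m \<rho> n \<pi>" and x: "x \<in> carrier G"
  shows "convolution G (rep_character \<pi>) (rep_character \<rho>) x = 0"
proof -
  have rep: "unitary_rep G n \<pi>" "unitary_rep G m \<rho>"
    using \<pi> \<rho> unfolding irreducible_unitary_rep_def by auto
  show ?thesis
    unfolding convolution_rep_character[OF rep x]
    by (simp add: schur_orthogonality_inequivalent[OF \<pi> \<rho> ne])
qed

lemma convolution_character_same:
  assumes fin: "finite (carrier G)" and \<pi>: "irreducible_unitary_rep G n \<pi>" and x: "x \<in> carrier G"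
  shows "convolution G (rep_character \<pi>) (rep_character \<pi>) x = rep_character \<pi> x / of_nat n"
proof -
  have rep: "unitary_rep G n \<pi>" using \<pi> unfolding irreducible_unitary_rep_def by auto
  have card: "card (carrier G) \<noteq> 0" using fin one_closed by auto
  let ?N = "of_nat (card (carrier G)) :: complex"
  have "convolution G (rep_character \<pi>) (rep_character \<pi>) x = 1 / ?N *
      (\<Sum>i<n. \<Sum>j<n. \<Sum>q<n. (if i = q \<and> i = j then ?N / of_nat n else 0) * \<pi> x $$ (q, j))"
    unfolding convolution_rep_character[OF rep rep x]
    by (simp add: schur_orthogonality_same[OF \<pi>])
  also have "(\<Sum>i<n. \<Sum>j<n. \<Sum>q<n. (if i = q \<and> i = j then ?N / of_nat n else 0) * \<pi> x $$ (q, j)) =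
      (\<Sum>i<n. \<Sum>j<n. if i = j then ?N / of_nat n * \<pi> x $$ (i, i) else 0)"
    by (intro sum.cong refl) (auto simp: if_distrib[of "\<lambda>c. c * _"] cong: if_cong)
  also have "\<dots> = ?N / of_nat n * (\<Sum>i<n. \<pi> x $$ (i, i))"
    by (simp add: sum_distrib_left)
  also have "(\<Sum>i<n. \<pi> x $$ (i, i)) = rep_character \<pi> x"
    using unitary_rep_carrier[OF rep x] by (simp add: rep_character_def mat_trace_def)
  finally show ?thesis using card by simp
qed

end

section \<open>Geometry of \<open>L\<^sup>2(G)\<close>\<close>

lemma L2_inner_self: "L2_inner G f f = of_real ((L2_norm G f)\<^sup>2)"
proof -
  have "L2_inner G f f = of_real (1 / real (card (carrier G)) * (\<Sum>x\<in>carrier G. (cmod (f x))\<^sup>2))"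
    unfolding L2_inner_def by (simp add: complex_norm_square[symmetric])
  then show ?thesis
    unfolding L2_norm_def by (simp add: sum_nonneg)
qed

lemma L2_norm_cong:
  assumes "\<And>x. x \<in> carrier G \<Longrightarrow> cmod (f x) = cmod (g x)"
  shows "L2_norm G f = L2_norm G g"
  unfolding L2_norm_def L2_inner_def
  using assms by (simp add: complex_norm_square[symmetric] cong: sum.cong)

lemma L2_inner_cong:
  assumes "\<And>x. x \<in> carrier G \<Longrightarrow> f x = f' x" "\<And>x. x \<in> carrier G \<Longrightarrow> g x = g' x"
  shows "L2_inner G f g = L2_inner G f' g'"
  unfolding L2_inner_def using assms by (simp cong: sum.cong)

lemma L2_inner_commute: "L2_inner G g f = cnj (L2_inner G f g)"
  unfolding L2_inner_def by (simp add: mult.commute)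

lemma L2_inner_diff_left:
  "L2_inner G (\<lambda>x. f x - g x) h = L2_inner G f h - L2_inner G g h"
  unfolding L2_inner_def by (simp add: algebra_simps sum_subtractf)

lemma L2_inner_diff_right:
  "L2_inner G h (\<lambda>x. f x - g x) = L2_inner G h f - L2_inner G h g"
  unfolding L2_inner_def by (simp add: algebra_simps sum_subtractf)

lemma L2_inner_sum_left:
  "L2_inner G (\<lambda>x. \<Sum>r\<in>R. c r * g r x) h = (\<Sum>r\<in>R. c r * L2_inner G (g r) h)"
proof -
  have "(\<Sum>x\<in>carrier G. (\<Sum>r\<in>R. c r * g r x) * cnj (h x)) =
      (\<Sum>r\<in>R. c r * (\<Sum>x\<in>carrier G. g r x * cnj (h x)))"
    unfolding sum_distrib_right sum_distrib_left
    by (subst sum.swap) (simp add: mult.assoc)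
  then show ?thesis
    unfolding L2_inner_def by (simp add: sum_distrib_left mult.left_commute)
qed

lemma L2_inner_sum_right:
  "L2_inner G h (\<lambda>x. \<Sum>r\<in>R. c r * g r x) = (\<Sum>r\<in>R. cnj (c r) * L2_inner G h (g r))"
  by (subst L2_inner_commute, subst L2_inner_sum_left)
    (simp add: L2_inner_commute[of G h])

lemma L2_norm_orthogonal_sum:
  assumes fin: "finite R"
    and orth: "\<And>r s. r \<in> R \<Longrightarrow> s \<in> R \<Longrightarrow> r \<noteq> s \<Longrightarrow> L2_inner G (g r) (g s) = 0"
  shows "(L2_norm G (\<lambda>x. \<Sum>r\<in>R. c r * g r x))\<^sup>2 = (\<Sum>r\<in>R. (cmod (c r))\<^sup>2 * (L2_norm G (g r))\<^sup>2)"
proof -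
  have "complex_of_real ((L2_norm G (\<lambda>x. \<Sum>r\<in>R. c r * g r x))\<^sup>2) =
      (\<Sum>r\<in>R. c r * (\<Sum>s\<in>R. cnj (c s) * L2_inner G (g r) (g s)))"
    unfolding L2_inner_self[symmetric] L2_inner_sum_left L2_inner_sum_right ..
  also have "\<dots> = (\<Sum>r\<in>R. c r * (\<Sum>s\<in>R. if s = r then cnj (c r) * L2_inner G (g r) (g r) else 0))"
    using orth by (intro sum.cong refl arg_cong2[of _ _ _ _ "(*)"]) auto
  also have "\<dots> = (\<Sum>r\<in>R. of_real ((cmod (c r))\<^sup>2 * (L2_norm G (g r))\<^sup>2))"
    using fin by (intro sum.cong refl) (simp add: L2_inner_self complex_norm_square[symmetric] mult.assoc[symmetric])
  also have "\<dots> = of_real (\<Sum>r\<in>R. (cmod (c r))\<^sup>2 * (L2_norm G (g r))\<^sup>2)" by simp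
  finally show ?thesis unfolding of_real_eq_iff .
qed

text \<open>
  Bessel's inequality for an orthogonal family \<open>g\<close> that need not be normalised; \<open>proj\<close> says that
  \<open>g r\<close> is the orthogonal projection of \<open>f\<close> to the line through \<open>g r\<close>.
\<close>

lemma L2_bessel:
  assumes fin: "finite R"
    and orth: "\<And>r s. r \<in> R \<Longrightarrow> s \<in> R \<Longrightarrow> r \<noteq> s \<Longrightarrow> L2_inner G (g r) (g s) = 0"
    and proj: "\<And>r. r \<in> R \<Longrightarrow> L2_inner G f (g r) = of_real ((L2_norm G (g r))\<^sup>2)"
  shows "(\<Sum>r\<in>R. (L2_norm G (g r))\<^sup>2) \<le> (L2_norm G f)\<^sup>2"
proof -
  define h where "h = (\<lambda>x. \<Sum>r\<in>R. 1 * g r x)"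
  define q where "q = (\<Sum>r\<in>R. (L2_norm G (g r))\<^sup>2)"
  have fh: "L2_inner G f h = of_real q"
    unfolding h_def q_def L2_inner_sum_right using proj by simp
  have hf: "L2_inner G h f = of_real q"
    by (subst L2_inner_commute) (simp add: fh)
  have "(L2_norm G h)\<^sup>2 = q"
    using L2_norm_orthogonal_sum[of R G g "\<lambda>_. 1", OF fin orth] by (simp add: h_def q_def)
  then have hh: "L2_inner G h h = of_real q" by (simp only: L2_inner_self)
  have "complex_of_real ((L2_norm G (\<lambda>x. f x - h x))\<^sup>2) = of_real ((L2_norm G f)\<^sup>2 - q)"
    unfolding L2_inner_self[symmetric] L2_inner_diff_left L2_inner_diff_right fh hf hh
    by (simp add: L2_inner_self)
  then have "(L2_norm G (\<lambda>x. f x - h x))\<^sup>2 = (L2_norm G f)\<^sup>2 - q" unfolding of_real_eq_iff .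
  then show ?thesis unfolding q_def by (metis diff_ge_0_iff_ge zero_le_power2)
qed

section \<open>Convolution\<close>

lemma convolution_sum_left:
  "convolution G (\<lambda>x. \<Sum>r\<in>R. c r * g r x) f x = (\<Sum>r\<in>R. c r * convolution G (g r) f x)"
proof -
  have "(\<Sum>y\<in>carrier G. (\<Sum>r\<in>R. c r * g r y) * f (inv\<^bsub>G\<^esub> y \<otimes>\<^bsub>G\<^esub> x)) =
      (\<Sum>r\<in>R. c r * (\<Sum>y\<in>carrier G. g r y * f (inv\<^bsub>G\<^esub> y \<otimes>\<^bsub>G\<^esub> x)))"
    unfolding sum_distrib_right sum_distrib_left
    by (subst sum.swap) (simp add: mult.assoc)
  then show ?thesis
    unfolding convolution_def by (simp add: sum_distrib_left mult.left_commute)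
qed

lemma convolution_scale_left:
  "convolution G (\<lambda>x. c * g x) f x = c * convolution G g f x"
  unfolding convolution_def by (simp add: sum_distrib_left mult_ac)

lemma convolution_scale_right:
  "convolution G g (\<lambda>x. c * f x) x = c * convolution G g f x"
  unfolding convolution_def by (simp add: sum_distrib_left mult_ac)

context group
begin

lemma sum_inv: "(\<Sum>y\<in>carrier G. h (inv y)) = (\<Sum>y\<in>carrier G. h y)"
  by (rule sum.reindex_bij_witness[of _ "m_inv G" "m_inv G"]) auto

lemma convolution_assoc:
  assumes x: "x \<in> carrier G"
  shows "convolution G (convolution G f g) h x = convolution G f (convolution G g h) x"
proof -
  let ?N = "of_nat (card (carrier G)) :: complex"
  have "(\<Sum>y\<in>carrier G. (\<Sum>z\<in>carrier G. f z * g (inv z \<otimes> y)) * h (inv y \<otimes> x)) =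
      (\<Sum>z\<in>carrier G. f z * (\<Sum>y\<in>carrier G. g (inv z \<otimes> y) * h (inv y \<otimes> x)))"
    unfolding sum_distrib_right sum_distrib_left
    by (subst sum.swap) (simp add: mult.assoc)
  also have "\<dots> = (\<Sum>z\<in>carrier G. f z * (\<Sum>w\<in>carrier G. g w * h (inv w \<otimes> (inv z \<otimes> x))))"
  proof (rule sum.cong[OF refl], rule arg_cong2[of _ _ _ _ "(*)", OF refl])
    fix z assume z: "z \<in> carrier G"
    have cancel: "z \<otimes> (inv z \<otimes> x) = x" using x z by (simp add: m_assoc[symmetric])
    have "(\<Sum>y\<in>carrier G. g (inv z \<otimes> y) * h (inv y \<otimes> x)) =
        (\<Sum>y\<in>carrier G. g (inv z \<otimes> y) * h (inv (inv z \<otimes> y) \<otimes> (inv z \<otimes> x)))"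
    proof (intro sum.cong refl)
      fix y assume y: "y \<in> carrier G"
      have "inv (inv z \<otimes> y) \<otimes> (inv z \<otimes> x) = inv y \<otimes> x"
        using x y z cancel by (simp add: inv_mult_group m_assoc)
      then show "g (inv z \<otimes> y) * h (inv y \<otimes> x) =
          g (inv z \<otimes> y) * h (inv (inv z \<otimes> y) \<otimes> (inv z \<otimes> x))" by simp
    qed
    also have "\<dots> = (\<Sum>w\<in>carrier G. g w * h (inv w \<otimes> (inv z \<otimes> x)))"
      using z by (intro sum_translate[of "inv z" "\<lambda>w. g w * h (inv w \<otimes> (inv z \<otimes> x))"]) simp
    finally show "(\<Sum>y\<in>carrier G. g (inv z \<otimes> y) * h (inv y \<otimes> x)) =
        (\<Sum>w\<in>carrier G. g w * h (inv w \<otimes> (inv z \<otimes> x)))" .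
  qed
  finally have *: "(\<Sum>y\<in>carrier G. (\<Sum>z\<in>carrier G. f z * g (inv z \<otimes> y)) * h (inv y \<otimes> x)) =
      (\<Sum>z\<in>carrier G. f z * (\<Sum>w\<in>carrier G. g w * h (inv w \<otimes> (inv z \<otimes> x))))" .
  have "convolution G (convolution G f g) h x =
      1 / ?N * (1 / ?N * (\<Sum>y\<in>carrier G. (\<Sum>z\<in>carrier G. f z * g (inv z \<otimes> y)) * h (inv y \<otimes> x)))"
    unfolding convolution_def by (simp add: sum_divide_distrib[symmetric])
  also have "\<dots> = convolution G f (convolution G g h) x"
    unfolding * unfolding convolution_def by (simp add: sum_divide_distrib[symmetric])
  finally show ?thesis .
qed

lemma convolution_self_adjoint:
  assumes h: "\<And>x. x \<in> carrier G \<Longrightarrow> h (inv x) = cnj (h x)"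
  shows "L2_inner G (convolution G h f) g = L2_inner G f (convolution G h g)"
proof -
  have "(\<Sum>x\<in>carrier G. (\<Sum>y\<in>carrier G. h y * f (inv y \<otimes> x)) * cnj (g x)) =
      (\<Sum>y\<in>carrier G. \<Sum>x\<in>carrier G. h y * f (inv y \<otimes> x) * cnj (g x))"
    unfolding sum_distrib_right by (rule sum.swap)
  also have "\<dots> = (\<Sum>y\<in>carrier G. \<Sum>x\<in>carrier G. h y * f x * cnj (g (y \<otimes> x)))"
  proof (rule sum.cong[OF refl])
    fix y assume y: "y \<in> carrier G"
    have "(\<Sum>x\<in>carrier G. h y * f (inv y \<otimes> x) * cnj (g x)) =
        (\<Sum>x\<in>carrier G. h y * f (inv y \<otimes> x) * cnj (g (y \<otimes> (inv y \<otimes> x))))"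
      using y by (intro sum.cong refl) (simp add: m_assoc[symmetric])
    also have "\<dots> = (\<Sum>x\<in>carrier G. h y * f x * cnj (g (y \<otimes> x)))"
      using y by (intro sum_translate[of "inv y" "\<lambda>x. h y * f x * cnj (g (y \<otimes> x))"]) simp
    finally show "(\<Sum>x\<in>carrier G. h y * f (inv y \<otimes> x) * cnj (g x)) =
        (\<Sum>x\<in>carrier G. h y * f x * cnj (g (y \<otimes> x)))" .
  qed
  also have "\<dots> = (\<Sum>y\<in>carrier G. \<Sum>x\<in>carrier G. h (inv y) * f x * cnj (g (inv y \<otimes> x)))"
    by (rule sum_inv[symmetric])
  also have "\<dots> = (\<Sum>x\<in>carrier G. f x * cnj (\<Sum>y\<in>carrier G. h y * g (inv y \<otimes> x)))"
    unfolding cnj_sum sum_distrib_left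
    by (subst sum.swap) (simp add: h mult_ac)
  finally have *: "(\<Sum>x\<in>carrier G. (\<Sum>y\<in>carrier G. h y * f (inv y \<otimes> x)) * cnj (g x)) =
      (\<Sum>x\<in>carrier G. f x * cnj (\<Sum>y\<in>carrier G. h y * g (inv y \<otimes> x)))" .
  let ?N = "of_nat (card (carrier G)) :: complex"
  have "L2_inner G (convolution G h f) g =
      1 / ?N * (1 / ?N * (\<Sum>x\<in>carrier G. (\<Sum>y\<in>carrier G. h y * f (inv y \<otimes> x)) * cnj (g x)))"
    unfolding L2_inner_def convolution_def by (simp add: sum_divide_distrib[symmetric])
  also have "\<dots> = L2_inner G f (convolution G h g)"
    unfolding * unfolding L2_inner_def convolution_def by (simp add: sum_divide_distrib[symmetric])
  finally show ?thesis .
qed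

lemma convolution_cong:
  assumes "\<And>y. y \<in> carrier G \<Longrightarrow> g y = g' y"
  shows "convolution G g f x = convolution G g' f x"
  unfolding convolution_def using assms by (simp cong: sum.cong)

end

section \<open>Frame bound\<close>

text \<open>
  If the \<open>e r\<close> are pairwise orthogonal self-adjoint idempotents under convolution, then the
  functions \<open>e r * f\<close> are pairwise orthogonal projections of \<open>f\<close>, and the filters
  \<open>\<Sum>\<^sub>r c j r \<cdot> e r\<close> act on them diagonally.
\<close>

lemma (in group) convolution_idempotents_energy:
  assumes fin: "finite R"
    and idem: "\<And>r s x. r \<in> R \<Longrightarrow> s \<in> R \<Longrightarrow> x \<in> carrier G \<Longrightarrow>
      convolution G (e r) (e s) x = (if r = s then e r x else 0)"
    and sym: "\<And>r x. r \<in> R \<Longrightarrow> x \<in> carrier G \<Longrightarrow> e r (inv x) = cnj (e r x)"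
    and sum1: "\<And>r. r \<in> R \<Longrightarrow> (\<Sum>j\<in>I. (cmod (c j r))\<^sup>2) = 1"
  shows "(\<Sum>j\<in>I. (L2_norm G (convolution G (\<lambda>x. \<Sum>r\<in>R. c j r * e r x) f))\<^sup>2) \<le> (L2_norm G f)\<^sup>2"
proof -
  define P where "P r = convolution G (e r) f" for r
  have PP: "L2_inner G (P r) (P s) = (if r = s then L2_inner G f (P r) else 0)"
    if rs: "r \<in> R" "s \<in> R" for r s
  proof -
    have "L2_inner G (P r) (P s) = L2_inner G f (convolution G (e r) (P s))"
      unfolding P_def using sym rs by (intro convolution_self_adjoint) auto
    also have "\<dots> = L2_inner G f (convolution G (convolution G (e r) (e s)) f)"
      unfolding P_def by (intro L2_inner_cong convolution_assoc[symmetric] refl)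
    also have "\<dots> = L2_inner G f (convolution G (\<lambda>x. if r = s then e r x else 0) f)"
      using rs by (intro L2_inner_cong refl convolution_cong) (simp add: idem)
    also have "\<dots> = (if r = s then L2_inner G f (P r) else 0)"
      by (auto simp: P_def L2_inner_def convolution_def)
    finally show ?thesis .
  qed
  have orth: "L2_inner G (P r) (P s) = 0" if "r \<in> R" "s \<in> R" "r \<noteq> s" for r s
    using PP that by simp
  have conv: "convolution G (\<lambda>x. \<Sum>r\<in>R. c j r * e r x) f = (\<lambda>x. \<Sum>r\<in>R. c j r * P r x)" for j
    unfolding P_def by (rule ext) (rule convolution_sum_left)
  have "(\<Sum>j\<in>I. (L2_norm G (convolution G (\<lambda>x. \<Sum>r\<in>R. c j r * e r x) f))\<^sup>2) =
      (\<Sum>j\<in>I. \<Sum>r\<in>R. (cmod (c j r))\<^sup>2 * (L2_norm G (P r))\<^sup>2)"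
    unfolding conv by (simp add: L2_norm_orthogonal_sum[OF fin orth])
  also have "\<dots> = (\<Sum>r\<in>R. (\<Sum>j\<in>I. (cmod (c j r))\<^sup>2) * (L2_norm G (P r))\<^sup>2)"
    unfolding sum_distrib_right by (rule sum.swap)
  also have "\<dots> = (\<Sum>r\<in>R. (L2_norm G (P r))\<^sup>2)"
    using sum1 by simp
  also have "\<dots> \<le> (L2_norm G f)\<^sup>2"
  proof (rule L2_bessel[OF fin orth])
    fix r assume "r \<in> R"
    then show "L2_inner G f (P r) = of_real ((L2_norm G (P r))\<^sup>2)"
      using PP[of r r] by (simp only: L2_inner_self if_True refl)
  qed
  finally show ?thesis .
qed

lemma (in group) wavelet_energy:
  assumes fin: "finite (carrier G)" and sys: "complete_irrep_system G k d \<pi>"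
    and norm: "\<And>r. r \<in> {1..k} \<Longrightarrow> (\<Sum>j=0..J. (cmod (\<gamma> j r))\<^sup>2) = 1"
  shows "(\<Sum>j=0..J. (L2_norm G (convolution G (wavelet k d \<pi> \<gamma> j) f))\<^sup>2) \<le> (L2_norm G f)\<^sup>2"
proof -
  \<comment> \<open>The factor \<open>d r\<close> makes the character idempotent, since \<open>\<chi>\<^sup>r * \<chi>\<^sup>r = \<chi>\<^sup>r / d r\<close>.\<close>
  define e where "e r x = of_nat (d r) * rep_character (\<pi> r) x" for r x
  have irr: "irreducible_unitary_rep G (d r) (\<pi> r)" if "r \<in> {1..k}" for r
    using sys that unfolding complete_irrep_system_def by blast
  have conv: "convolution G (e r) (e s) x =
      of_nat (d r) * (of_nat (d s) * convolution G (rep_character (\<pi> r)) (rep_character (\<pi> s)) x)" for r s x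
    unfolding e_def[abs_def] convolution_scale_left convolution_scale_right ..
  have wav: "wavelet k d \<pi> \<gamma> j = (\<lambda>x. \<Sum>r=1..k. \<gamma> j r * e r x)" for j
    by (simp add: wavelet_def e_def fun_eq_iff mult_ac)
  show ?thesis
    unfolding wav
  proof (rule convolution_idempotents_energy[OF _ _ _ norm])
    fix r s x assume rs: "r \<in> {1..k}" "s \<in> {1..k}" and x: "x \<in> carrier G"
    show "convolution G (e r) (e s) x = (if r = s then e r x else 0)"
    proof (cases "r = s")
      case True
      have "d r > 0" using irr[OF rs(1)] unfolding irreducible_unitary_rep_def by simp
      then show ?thesis
        using True by (simp add: conv convolution_character_same[OF fin irr[OF rs(2)] x] e_def)
    next
      case False
      then have "\<not> equivalent_reps G (d s) (\<pi> s) (d r) (\<pi> r)"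
        using sys rs unfolding complete_irrep_system_def by metis
      from convolution_character_inequivalent[OF irr[OF rs(1)] irr[OF rs(2)] this x] show ?thesis
        using False by (simp add: conv)
    qed
  next
    fix r x assume r: "r \<in> {1..k}" and x: "x \<in> carrier G"
    have rep: "unitary_rep G (d r) (\<pi> r)" using irr[OF r] unfolding irreducible_unitary_rep_def by simp
    show "e r (inv x) = cnj (e r x)"
      by (simp add: e_def rep_character_inv[OF rep x])
  qed auto
qed

section \<open>Energy propagation along paths\<close>

text \<open>
  Induction on the length bound, for all signals at once: a nonempty path \<open>j # p\<close> contributes to the
  energy of \<open>f\<close> what \<open>p\<close> contributes to that of \<open>\<bar>\<psi>\<^sub>j * f\<bar>\<close>, which has the same norm as \<open>\<psi>\<^sub>j * f\<close>.
  The term \<open>j = 0\<close> of \<open>bound\<close> pays for the empty path.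
\<close>

lemma scattering_finite_energy:
  fixes \<psi> :: "nat \<Rightarrow> 'a \<Rightarrow> complex"
  assumes bound: "\<And>f. (\<Sum>j=0..J. (L2_norm G (convolution G (\<psi> j) f))\<^sup>2) \<le> (L2_norm G f)\<^sup>2"
  shows "(\<Sum>p | length p < m \<and> set p \<subseteq> {1..J}. (L2_norm G (scattering G \<psi> f p))\<^sup>2) \<le> (L2_norm G f)\<^sup>2"
proof (induction m arbitrary: f)
  case 0
  then show ?case by simp
next
  case (Suc m)
  define A where "A = {p. length p < m \<and> set p \<subseteq> {1..J}}"
  define g where "g j = (\<lambda>x. complex_of_real (cmod (convolution G (\<psi> j) f x)))" for j
  have "finite A"
    by (rule finite_subset[OF _ finite_lists_length_le[of "{1..J}" m]]) (auto simp: A_def)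
  have split: "{p. length p < Suc m \<and> set p \<subseteq> {1..J}} = insert [] (case_prod (#) ` ({1..J} \<times> A))"
  proof (rule Set.set_eqI)
    fix p show "p \<in> {p. length p < Suc m \<and> set p \<subseteq> {1..J}} \<longleftrightarrow>
        p \<in> insert [] (case_prod (#) ` ({1..J} \<times> A))"
      by (cases p) (auto simp: A_def)
  qed
  have "(\<Sum>p\<in>insert [] (case_prod (#) ` ({1..J} \<times> A)). (L2_norm G (scattering G \<psi> f p))\<^sup>2) =
      (L2_norm G (convolution G (\<psi> 0) f))\<^sup>2 +
      (\<Sum>p\<in>case_prod (#) ` ({1..J} \<times> A). (L2_norm G (scattering G \<psi> f p))\<^sup>2)"
    using \<open>finite A\<close> by (subst sum.insert) (auto simp: scattering_def)
  also have "(\<Sum>p\<in>case_prod (#) ` ({1..J} \<times> A). (L2_norm G (scattering G \<psi> f p))\<^sup>2) =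
      (\<Sum>j=1..J. \<Sum>p\<in>A. (L2_norm G (scattering G \<psi> (g j) p))\<^sup>2)"
    by (subst sum.reindex)
      (auto simp: inj_on_def sum.cartesian_product scattering_def g_def intro!: sum.cong)
  also have "\<dots> \<le> (\<Sum>j=1..J. (L2_norm G (g j))\<^sup>2)"
    by (intro sum_mono Suc.IH[folded A_def])
  also have "\<dots> = (\<Sum>j=1..J. (L2_norm G (convolution G (\<psi> j) f))\<^sup>2)"
    by (intro sum.cong refl arg_cong[of _ _ "\<lambda>t. t\<^sup>2"] L2_norm_cong) (simp add: g_def)
  also have "(L2_norm G (convolution G (\<psi> 0) f))\<^sup>2 + \<dots> =
      (\<Sum>j=0..J. (L2_norm G (convolution G (\<psi> j) f))\<^sup>2)"
    by (simp add: sum.atLeast_Suc_atMost)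
  also have "\<dots> \<le> (L2_norm G f)\<^sup>2" by (rule bound)
  finally show ?case unfolding split by simp
qed

theorem lemma4p1:
  fixes G :: "('a, 'b) monoid_scheme"
    and k J :: nat
    and d :: "nat \<Rightarrow> nat"
    and \<pi> :: "nat \<Rightarrow> 'a \<Rightarrow> complex mat"
    and \<gamma> :: "nat \<Rightarrow> nat \<Rightarrow> complex"
    and f :: "'a \<Rightarrow> complex"
  assumes "group G" and "finite (carrier G)"
    and "complete_irrep_system G k d \<pi>"
    and "J \<ge> 1"
    and "\<And>r. r \<in> {1..k} \<Longrightarrow> (\<Sum>j=1..J. (cmod (\<gamma> j r))\<^sup>2) = 1 - (cmod (\<gamma> 0 r))\<^sup>2"
  shows "finite_path_norm G J (scattering G (wavelet k d \<pi> \<gamma>) f) \<and>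
         path_norm G J (scattering G (wavelet k d \<pi> \<gamma>) f) \<le> L2_norm G f"
proof -
  interpret group G by fact
  define h where "h p = (L2_norm G (scattering G (wavelet k d \<pi> \<gamma>) f p))\<^sup>2" for p
  have "(\<Sum>j=0..J. (cmod (\<gamma> j r))\<^sup>2) = 1" if "r \<in> {1..k}" for r
    using assms(5)[OF that] by (simp add: sum.atLeast_Suc_atMost)
  then have energy: "(\<Sum>j=0..J. (L2_norm G (convolution G (wavelet k d \<pi> \<gamma> j) g))\<^sup>2) \<le> (L2_norm G g)\<^sup>2"
    for g
    by (rule wavelet_energy[OF assms(2,3)])
  have bound: "sum h F \<le> (L2_norm G f)\<^sup>2" if F: "finite F" "F \<subseteq> scattering_paths J" for F
  proof -
    \<comment> \<open>A finite set of paths lies among the finitely many paths below some length.\<close>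
    obtain m where m: "length p < m" if "p \<in> F" for p
      using F(1) finite_nat_set_iff_bounded[of "length ` F"] by auto
    let ?A = "{p. length p < m \<and> set p \<subseteq> {1..J}}"
    have "finite ?A"
      by (rule finite_subset[OF _ finite_lists_length_le[of "{1..J}" m]]) auto
    moreover have "F \<subseteq> ?A"
      using F(2) m by (auto simp: scattering_paths_def paths_of_length_def)
    ultimately have "sum h F \<le> sum h ?A" by (intro sum_mono2) (auto simp: h_def)
    also have "\<dots> \<le> (L2_norm G f)\<^sup>2" unfolding h_def by (rule scattering_finite_energy[OF energy])
    finally show ?thesis .
  qed
  have summable: "h summable_on scattering_paths J"
    by (rule nonneg_bdd_above_summable_on) (auto simp: h_def[symmetric] intro!: bdd_aboveI2 bound, simp add: h_def)
  have "infsum h (scattering_paths J) \<le> (L2_norm G f)\<^sup>2"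
    by (rule infsum_le_finite_sums[OF summable bound])
  moreover have "L2_norm G f \<ge> 0"
    unfolding L2_norm_def L2_inner_def by (simp add: complex_norm_square[symmetric] sum_nonneg)
  ultimately have "sqrt (infsum h (scattering_paths J)) \<le> L2_norm G f"
    by (simp add: real_le_lsqrt)
  with summable show ?thesis
    unfolding finite_path_norm_def path_norm_def h_def by simp
qed

end
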